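(* Let $n\ge 1$ be an integer and $\ell:=\lfloor (n-1)/2\rfloor$. On the space of generic asymptotic data, with coordinates $(\gamma_0,\dots,\gamma_\ell,\rho_0,\dots,\rho_\ell)$, let $m_i$ and $e_i^{\mathbb R}$ ($0\le i\le \ell$) be the monodromy data, regarded as functions of the asymptotic data. Then $$-\frac12\sum_{i=0}^{\ell} d\gamma_i\wedge d\rho_i=\sum_{i=0}^{\ell} dm_i\wedge d\log e_i^{\mathbb R}.$$
   Context: The tt*-Toda equations are $2(w_i)_{t\bar t}=-e^{2(w_{i+1}-w_i)}+e^{2(w_i-w_{i-1})}$ for $w_i:\mathbb C^*\to\mathbb R$, $i\in\mathbb Z$, with $w_{i+n+1}=w_i$, $w_i=w_i(|t|)$ and $w_i+w_{n-i}=0$. Their generic local solutions near $x=|t|=0$ are parametrized by real asymptotic data $\gamma_i,\rho_i$ through $2w_i(x)=\gamma_i\log x+\rho_i+o(1)$ as $x\to0$. Conventions on the data: $\gamma_{i+n+1}=\gamma_i$ and $\gamma_{n-i}=-\gamma_i$ for all $i$, and likewise for $\rho_i$ (so when $n$ is even $\gamma_{n/2}=\rho_{n/2}=0$). Hence $(\gamma_0,\dots,\gamma_\ell,\rho_0,\dots,\rho_\ell)$ are independent coordinates. "Generic" means $-2<\gamma_{i+1}-\gamma_i<2$ for all $i\in\mathbb Z$, and this is assumed; the $\rho_i$ ($0\le i\le\ell$) are arbitrary reals. The monodromy data are given in terms of the asymptotic data by the formulas (taken here as their definition) $$m_i=-\tfrac12\gamma_i,\qquad e_i^{\mathbb R}=e^{\rho_i}\,2^{2\gamma_i}\,\frac{X_{n-i}(\gamma_0,\dots,\gamma_n)}{X_i(\gamma_0,\dots,\gamma_n)},$$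 where $(\gamma_0,\dots,\gamma_n)$ is the full antisymmetric vector determined by $\gamma_0,\dots,\gamma_\ell$, and $$X_k(\gamma_0,\dots,\gamma_n):=\prod_{j=1}^{n}\Gamma\left(\frac{\gamma_{k+j}-\gamma_k+2j}{2(n+1)}\right),\qquad \gamma_{j+n+1}=\gamma_j,$$ with $\Gamma$ the Euler Gamma function. *)

theory Defs
  imports "HOL-Analysis.Analysis"
begin

section \<open>Differential forms on a normed space\<close>

text \<open>
  A 1-form on \<open>'e\<close> assigns to each point a linear functional, a 2-form an alternating bilinear
  form. The derivative in \<open>ext_d\<close> is the full Frechet derivative on the ambient
  space, so it is meaningful at points where the function is differentiable; for the functions
  used below this is shown on all of \<open>generic\<close> (lemma \<open>monodromy_data_differentiable\<close>).
\<close>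

definition ext_d :: "('e::real_normed_vector \<Rightarrow> real) \<Rightarrow> 'e \<Rightarrow> 'e \<Rightarrow> real" where
  "ext_d f p = frechet_derivative f (at p)"

definition wedge :: "('e \<Rightarrow> 'e \<Rightarrow> real) \<Rightarrow> ('e \<Rightarrow> 'e \<Rightarrow> real) \<Rightarrow> 'e \<Rightarrow> 'e \<Rightarrow> 'e \<Rightarrow> real" where
  "wedge \<alpha> \<beta> p u v = \<alpha> p u * \<beta> p v - \<alpha> p v * \<beta> p u"


section \<open>Asymptotic data\<close>

definition ell :: "nat \<Rightarrow> nat" where
  "ell n = (n - 1) div 2"

text \<open>
  A point \<open>(g, r)\<close> holds the independent coordinates \<open>\<gamma>\<^sub>0, \<dots>, \<gamma>\<^sub>\<ell>\<close> in \<open>g\<close> and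
  \<open>\<rho>\<^sub>0, \<dots>, \<rho>\<^sub>\<ell>\<close> in \<open>r\<close>. The index type \<open>'l\<close> has \<open>\<ell> + 1\<close> elements, labelled by a bijection
  \<open>ix\<close> from \<open>{0..\<ell>}\<close> onto \<open>'l\<close>: the \<open>i\<close>-th coordinate is the component at \<open>ix i\<close>.
\<close>

type_synonym 'l asym_data = "(real ^ 'l) \<times> (real ^ 'l)"

text \<open>
  The extension of \<open>x\<^sub>0, \<dots>, x\<^sub>\<ell>\<close> to the sequence over the integers with \<open>x\<^sub>i\<^sub>+\<^sub>n\<^sub>+\<^sub>1 = x\<^sub>i\<close> and
  \<open>x\<^sub>n\<^sub>-\<^sub>i = - x\<^sub>i\<close>. The last case only arises for even \<open>n\<close>, at the middle index \<open>n/2\<close>.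
\<close>

definition extend :: "nat \<Rightarrow> (nat \<Rightarrow> 'l::finite) \<Rightarrow> real ^ 'l \<Rightarrow> int \<Rightarrow> real" where
  "extend n ix x k =
    (let r = nat (k mod (int n + 1)) in
       if r \<le> ell n then x $ ix r
       else if n - r \<le> ell n then - (x $ ix (n - r))
       else 0)"

definition gam :: "nat \<Rightarrow> (nat \<Rightarrow> 'l::finite) \<Rightarrow> int \<Rightarrow> 'l asym_data \<Rightarrow> real" where
  "gam n ix k p = extend n ix (fst p) k"

definition rho :: "nat \<Rightarrow> (nat \<Rightarrow> 'l::finite) \<Rightarrow> int \<Rightarrow> 'l asym_data \<Rightarrow> real" where
  "rho n ix k p = extend n ix (snd p) k"

definition generic :: "nat \<Rightarrow> (nat \<Rightarrow> 'l::finite) \<Rightarrow> 'l asym_data set" where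
  "generic n ix =
    {p. \<forall>k::int. -2 < gam n ix (k + 1) p - gam n ix k p \<and> gam n ix (k + 1) p - gam n ix k p < 2}"


section \<open>Monodromy data\<close>

definition X :: "nat \<Rightarrow> int \<Rightarrow> (int \<Rightarrow> real) \<Rightarrow> real" where
  "X n k \<gamma> = (\<Prod>j=1..n. Gamma ((\<gamma> (k + int j) - \<gamma> k + 2 * real j) / (2 * (real n + 1))))"

definition mon_m :: "nat \<Rightarrow> (nat \<Rightarrow> 'l::finite) \<Rightarrow> nat \<Rightarrow> 'l asym_data \<Rightarrow> real" where
  "mon_m n ix i p = - (1/2) * gam n ix (int i) p"

definition mon_e :: "nat \<Rightarrow> (nat \<Rightarrow> 'l::finite) \<Rightarrow> nat \<Rightarrow> 'l asym_data \<Rightarrow> real" where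
  "mon_e n ix i p =
    exp (rho n ix (int i) p) * 2 powr (2 * gam n ix (int i) p) *
      (X n (int n - int i) (\<lambda>k. gam n ix k p) / X n (int i) (\<lambda>k. gam n ix k p))"


section \<open>Consistency of the definitions\<close>

lemma extend_coordinate: "i \<le> ell n \<Longrightarrow> extend n ix x (int i) = x $ ix i"
proof -
  assume i: "i \<le> ell n"
  have "i \<le> n"
    using i by (simp add: ell_def)
  then have "int i mod (int n + 1) = int i"
    by simp
  then show ?thesis
    using i by (simp add: extend_def)
qed

lemma extend_periodic: "extend n ix x (k + int n + 1) = extend n ix x k"
proof -
  have "(k + int n + 1) mod (int n + 1) = k mod (int n + 1)"
    by (metis add.assoc mod_add_self2)
  then show ?thesis
    by (simp add: extend_def)
qed

lemma extend_antisymmetric: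
  assumes "n \<ge> 1"
  shows "extend n ix x (int n - k) = - extend n ix x k"
proof -
  define r where "r = nat (k mod (int n + 1))"
  have r: "k mod (int n + 1) = int r" "r \<le> n"
    using pos_mod_bound[of "int n + 1" k] by (auto simp: r_def nat_le_iff)
  have "(int n - k) mod (int n + 1) = (int n - int r) mod (int n + 1)"
    by (metis mod_diff_right_eq r(1))
  also have "\<dots> = int (n - r)"
    using r(2) by (simp add: of_nat_diff)
  finally have s: "(int n - k) mod (int n + 1) = int (n - r)" .
  have excl: "\<not> (r \<le> ell n \<and> n - r \<le> ell n)"
    using assms r(2) unfolding ell_def by linarith
  have "nat ((int n - k) mod (int n + 1)) = n - r" "nat (k mod (int n + 1)) = r" "n - (n - r) = r"
    using s r by simp_all
  then show ?thesis
    using excl unfolding extend_def Let_def by auto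
qed

lemma extend_unique:
  fixes y :: "int \<Rightarrow> real"
  assumes "n \<ge> 1"
    and coord: "\<And>i. i \<le> ell n \<Longrightarrow> y (int i) = x $ ix i"
    and per: "\<And>k. y (k + int n + 1) = y k"
    and anti: "\<And>k. y (int n - k) = - y k"
  shows "y = extend n ix x"
proof
  fix k :: int
  have up: "y (k + int j * (int n + 1)) = y k" for k j
  proof (induction j)
    case (Suc j)
    have "y (k + int (Suc j) * (int n + 1)) = y ((k + int j * (int n + 1)) + int n + 1)"
      by (simp add: algebra_simps)
    then show ?case
      using per Suc by simp
  qed simp
  have shift: "y (k + q * (int n + 1)) = y k" for k q
  proof (cases "q \<ge> 0")
    case True
    then show ?thesis using up[of k "nat q"] by simp
  next
    case False
    then show ?thesis using up[of "k + q * (int n + 1)" "nat (- q)"] by (simp add: algebra_simps)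
  qed
  define r where "r = nat (k mod (int n + 1))"
  have r: "k mod (int n + 1) = int r" "r \<le> n"
    using pos_mod_bound[of "int n + 1" k] by (auto simp: r_def nat_le_iff)
  have "y k = y (int r)"
    using shift[of "int r" "k div (int n + 1)"] r(1)
    by (metis add.commute div_mult_mod_eq)
  moreover have "y (int r) = - y (int (n - r))"
    using anti[of "int (n - r)"] r(2) by (simp add: of_nat_diff)
  moreover have "y (int r) = 0" if "\<not> r \<le> ell n" "\<not> n - r \<le> ell n"
  proof -
    have "n - r = r"
      using that r(2) unfolding ell_def by linarith
    then show ?thesis
      using \<open>y (int r) = - y (int (n - r))\<close> by simp
  qed
  ultimately show "y k = extend n ix x k"
    using coord by (auto simp: extend_def r(1) Let_def)
qed

lemma bounded_linear_extend: "bounded_linear (\<lambda>x. extend n ix x k)"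
  unfolding extend_def Let_def
  by (cases "nat (k mod (int n + 1)) \<le> ell n";
      cases "n - nat (k mod (int n + 1)) \<le> ell n";
      simp add: bounded_linear_vec_nth bounded_linear_minus)

lemma bounded_linear_gam: "bounded_linear (gam n ix k)"
  using bounded_linear_compose[OF bounded_linear_extend bounded_linear_fst]
  by (simp add: gam_def[abs_def])

lemma bounded_linear_rho: "bounded_linear (rho n ix k)"
  using bounded_linear_compose[OF bounded_linear_extend bounded_linear_snd]
  by (simp add: rho_def[abs_def])

lemma open_generic: "open (generic n ix)"
proof -
  define D where "D k p = gam n ix (k + 1) p - gam n ix k p" for k p
  define N where "N = int n + 1"
  have red: "extend n ix x k = extend n ix x (k mod N)" for x k
    by (simp add: extend_def N_def)
  have red1: "extend n ix x (k + 1) = extend n ix x (k mod N + 1)" for x k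
    by (simp add: extend_def N_def mod_add_left_eq)
  have D: "D k p = D (k mod N) p" for k p
    unfolding D_def gam_def using red red1 by metis
  have "generic n ix = (\<Inter>k\<in>{0..<N}. {p. -2 < D k p} \<inter> {p. D k p < 2})"
  proof -
    have N: "k mod N \<in> {0..<N}" for k
      using pos_mod_bound[of N k] pos_mod_sign[of N k] by (simp add: N_def)
    have "(\<forall>k. -2 < D k p \<and> D k p < 2) \<longleftrightarrow> (\<forall>k\<in>{0..<N}. -2 < D k p \<and> D k p < 2)" for p
      by (metis D N)
    then show ?thesis
      unfolding generic_def D_def[symmetric] by auto
  qed
  moreover have "continuous_on UNIV (D k)" for k
    unfolding D_def[abs_def]
    by (intro continuous_intros linear_continuous_on bounded_linear_gam)
  ultimately show ?thesis
    by (auto intro!: open_INT open_Int open_Collect_less continuous_intros)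
qed

lemma Gamma_arg_pos:
  assumes "p \<in> generic n ix" "j \<ge> 1"
  shows "(gam n ix (k + int j) p - gam n ix k p + 2 * real j) / (2 * (real n + 1)) > 0"
proof -
  have step: "gam n ix (i + 1) p - gam n ix i p > -2" for i
    using assms(1) by (simp add: generic_def)
  have "gam n ix (k + int j) p - gam n ix k p + 2 * real j > 0"
    using assms(2)
  proof (induction j rule: nat_induct_at_least)
    case base
    then show ?case using step[of k] by simp
  next
    case (Suc j)
    then show ?case using step[of "k + int j"] by (simp add: algebra_simps)
  qed
  then show ?thesis by simp
qed

lemma X_pos:
  assumes "p \<in> generic n ix"
  shows "X n k (\<lambda>k. gam n ix k p) > 0"
  unfolding X_def using Gamma_arg_pos[OF assms]
  by (intro prod_pos) (auto intro!: Gamma_real_pos)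

lemma mon_e_pos: "p \<in> generic n ix \<Longrightarrow> mon_e n ix i p > 0"
  unfolding mon_e_def by (auto intro!: mult_pos_pos divide_pos_pos X_pos)

lemma X_differentiable:
  assumes "p \<in> generic n ix"
  shows "(\<lambda>p. X n k (\<lambda>k. gam n ix k p)) differentiable (at p)"
proof -
  have g: "(gam n ix m) differentiable (at p)" for m
    by (rule bounded_linear_imp_differentiable[OF bounded_linear_gam])
  have "(\<lambda>p. Gamma ((gam n ix (k + int j) p - gam n ix k p + 2 * real j) / (2 * (real n + 1))))
      differentiable (at p)" if "j \<ge> 1" for j
  proof -
    let ?h = "\<lambda>p. (gam n ix (k + int j) p - gam n ix k p + 2 * real j) / (2 * (real n + 1))"
    have h: "?h differentiable (at p)"
      by (intro derivative_intros g) auto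
    have "?h p \<notin> \<int>\<^sub>\<le>\<^sub>0"
      using Gamma_arg_pos[OF assms that, of k] nonpos_Ints_nonpos by fastforce
    then have "Gamma differentiable (at (?h p))"
      using has_field_derivative_Gamma real_differentiable_def by blast
    from differentiable_chain_at[OF h this] show ?thesis
      by (simp add: o_def)
  qed
  then have "\<forall>j\<in>{1..n}. \<exists>D. ((\<lambda>p. Gamma ((gam n ix (k + int j) p - gam n ix k p + 2 * real j)
      / (2 * (real n + 1)))) has_derivative D) (at p)"
    by (simp add: differentiable_def)
  from bchoice[OF this] obtain D where "\<forall>j\<in>{1..n}. ((\<lambda>p. Gamma ((gam n ix (k + int j) p - gam n ix k p
      + 2 * real j) / (2 * (real n + 1)))) has_derivative D j) (at p)"
    by blast
  then show ?thesis
    unfolding X_def differentiable_def by (intro exI) (rule has_derivative_prod, blast)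
qed

lemma monodromy_data_differentiable:
  assumes "p \<in> generic n ix"
  shows "mon_m n ix i differentiable (at p)"
    and "(\<lambda>p. ln (mon_e n ix i p)) differentiable (at p)"
proof -
  have g: "gam n ix m differentiable (at p)" and r: "rho n ix m differentiable (at p)" for m
    by (rule bounded_linear_imp_differentiable[OF bounded_linear_gam],
        rule bounded_linear_imp_differentiable[OF bounded_linear_rho])
  show "mon_m n ix i differentiable (at p)"
    unfolding mon_m_def[abs_def] by (intro derivative_intros g)
  define F where "F q = rho n ix (int i) q + 2 * gam n ix (int i) q * ln 2
      + (ln (X n (int n - int i) (\<lambda>k. gam n ix k q)) - ln (X n (int i) (\<lambda>k. gam n ix k q)))" for q
  have lnX: "(\<lambda>q. ln (X n k (\<lambda>k. gam n ix k q))) differentiable (at p)" for k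
  proof -
    have "(ln :: real \<Rightarrow> real) differentiable (at (X n k (\<lambda>k. gam n ix k p)))"
      using DERIV_ln[OF X_pos[OF assms]] real_differentiable_def by blast
    from differentiable_chain_at[OF X_differentiable[OF assms] this] show ?thesis
      by (simp add: o_def)
  qed
  have "F differentiable (at p)"
    unfolding F_def[abs_def] by (intro derivative_intros g r lnX)
  moreover have eq: "ln (mon_e n ix i q) = F q" if "q \<in> generic n ix" for q
  proof -
    have pos: "X n k (\<lambda>k. gam n ix k q) > 0" for k
      by (rule X_pos[OF that])
    then have nz: "X n k (\<lambda>k. gam n ix k q) \<noteq> 0" for k
      by (simp add: less_imp_neq[THEN not_sym])
    show ?thesis
      unfolding mon_e_def F_def
      by (simp add: ln_mult_pos ln_div pos nz ln_powr)
  qed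
  ultimately obtain F' where F': "(F has_derivative F') (at p)"
    by (auto simp: differentiable_def)
  have "((\<lambda>q. ln (mon_e n ix i q)) has_derivative F') (at p)"
    by (rule has_derivative_transform_within_open[OF F' open_generic assms]) (simp add: eq)
  then show "(\<lambda>p. ln (mon_e n ix i p)) differentiable (at p)"
    by (auto simp: differentiable_def)
qed

end

theory Submission
  imports Defs
begin

text \<open>
  Taking logarithms, \<open>log e\<^sub>i = \<rho>\<^sub>i + 2 \<gamma>\<^sub>i log 2 + log X\<^sub>n\<^sub>-\<^sub>i - log X\<^sub>i\<close>. Wedging with \<open>d\<gamma>\<^sub>i\<close> kills the
  second term, so the claim is that the sum over \<open>0 \<le> i \<le> \<ell>\<close> of
  \<open>d\<gamma>\<^sub>i \<and> (d log X\<^sub>n\<^sub>-\<^sub>i - d log X\<^sub>i)\<close> vanishes. Since \<open>d\<gamma>\<^sub>n\<^sub>-\<^sub>i = - d\<gamma>\<^sub>i\<close>, that sum is the negative of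
  the sum of \<open>d\<gamma>\<^sub>k \<and> d log X\<^sub>k\<close> over a full period \<open>0 \<le> k \<le> n\<close>.

  Write \<open>a\<^sub>k\<^sub>,\<^sub>j\<close> for the arguments of the Gamma function in \<open>X\<^sub>k\<close> and \<open>\<psi>\<close> for the digamma function.
  Up to the factor \<open>1 / (2 (n + 1))\<close> the sum over the period is the sum over \<open>j\<close> of
    \<open>\<Sum>\<^sub>k \<psi> (a\<^sub>k\<^sub>,\<^sub>j) d\<gamma>\<^sub>k \<and> d\<gamma>\<^sub>k\<^sub>+\<^sub>j\<close>.
  For fixed \<open>j\<close> the reflection \<open>k \<mapsto> n - j - k\<close> of the residues modulo \<open>n + 1\<close> sends the pair
  \<open>(k, k + j)\<close> to \<open>(n - (k + j), n - k)\<close>. By antisymmetry of \<open>\<gamma>\<close> it preserves the difference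
  \<open>\<gamma>\<^sub>k\<^sub>+\<^sub>j - \<gamma>\<^sub>k\<close>, hence \<open>a\<^sub>k\<^sub>,\<^sub>j\<close>, while it exchanges the two factors of the wedge product. So each of
  these sums equals its own negative (\<open>sum_wedge_digamma_zero\<close>).
\<close>

section \<open>Sums over a period\<close>

lemma sum_periodic_reflect:
  fixes f :: "int \<Rightarrow> real"
  assumes "N > 0" and per: "\<And>k. f (k mod N) = f k"
  shows "(\<Sum>k\<in>{0..<N}. f (c - k)) = (\<Sum>k\<in>{0..<N}. f k)"
proof (rule sum.reindex_bij_witness[where i = "\<lambda>k. (c - k) mod N" and j = "\<lambda>k. (c - k) mod N"])
  fix k assume k: "k \<in> {0..<N}"
  show "(c - (c - k) mod N) mod N = k"
    using k by (simp add: mod_diff_right_eq)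
  show "(c - (c - k) mod N) mod N = k"
    using k by (simp add: mod_diff_right_eq)
  show "f ((c - k) mod N) = f (c - k)"
    by (rule per)
qed (use assms(1) in auto)

text \<open>
  The indices \<open>i\<close> and \<open>n - i\<close> with \<open>i \<le> \<ell>\<close> exhaust \<open>{0..n}\<close> except for \<open>n / 2\<close> when \<open>n\<close> is even.
\<close>

lemma sum_fold_ell:
  fixes f :: "nat \<Rightarrow> real"
  assumes "n \<ge> 1" and mid: "\<And>k. 2 * k = n \<Longrightarrow> f k = 0"
  shows "(\<Sum>i=0..ell n. f i + f (n - i)) = (\<Sum>k=0..n. f k)"
proof -
  have upper: "(\<Sum>i=0..ell n. f (n - i)) = (\<Sum>k=n - ell n..n. f k)"
    by (rule sum.reindex_bij_witness[where i = "\<lambda>k. n - k" and j = "\<lambda>k. n - k"])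
       (use assms(1) in \<open>auto simp: ell_def\<close>)
  have "(\<Sum>k=0..n. f k) = (\<Sum>k\<in>{0..ell n} \<union> {n - ell n..n}. f k)"
  proof (rule sum.mono_neutral_right)
    show "\<forall>k\<in>{0..n} - ({0..ell n} \<union> {n - ell n..n}). f k = 0"
    proof
      fix k assume "k \<in> {0..n} - ({0..ell n} \<union> {n - ell n..n})"
      then have "2 * k = n"
        using assms(1) unfolding ell_def by auto
      then show "f k = 0" by (rule mid)
    qed
  qed (use assms(1) in \<open>auto simp: ell_def\<close>)
  also have "\<dots> = (\<Sum>k=0..ell n. f k) + (\<Sum>k=n - ell n..n. f k)"
    by (rule sum.union_disjoint) (use assms(1) in \<open>auto simp: ell_def\<close>)
  finally show ?thesis
    by (simp add: sum.distrib upper)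
qed

section \<open>The logarithmic derivatives of the Gamma products\<close>

lemma ext_d_eqI: "(f has_derivative f') (at p) \<Longrightarrow> ext_d f p = f'"
  unfolding ext_d_def using frechet_derivative_at by metis

lemma gam_has_derivative: "(gam n ix k has_derivative gam n ix k) (at p)"
  by (rule bounded_linear_imp_has_derivative[OF bounded_linear_gam])

lemma rho_has_derivative: "(rho n ix k has_derivative rho n ix k) (at p)"
  by (rule bounded_linear_imp_has_derivative[OF bounded_linear_rho])

lemma gam_mod: "gam n ix (k mod (int n + 1)) p = gam n ix k p"
  by (simp add: gam_def extend_def)

lemma gam_reflect: "n \<ge> 1 \<Longrightarrow> gam n ix (int n - k) p = - gam n ix k p"
  by (simp add: gam_def extend_antisymmetric)

definition Gamma_arg :: "nat \<Rightarrow> (nat \<Rightarrow> 'l::finite) \<Rightarrow> int \<Rightarrow> nat \<Rightarrow> 'l asym_data \<Rightarrow> real" where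
  "Gamma_arg n ix k j p =
    (gam n ix (k + int j) p - gam n ix k p + 2 * real j) / (2 * (real n + 1))"

definition dlog_X :: "nat \<Rightarrow> (nat \<Rightarrow> 'l::finite) \<Rightarrow> int \<Rightarrow> 'l asym_data \<Rightarrow> 'l asym_data \<Rightarrow> real" where
  "dlog_X n ix k p h = (\<Sum>j=1..n. Digamma (Gamma_arg n ix k j p) *
      ((gam n ix (k + int j) h - gam n ix k h) / (2 * (real n + 1))))"

lemma ln_X_has_derivative:
  assumes "p \<in> generic n ix"
  shows "((\<lambda>q. ln (X n k (\<lambda>k. gam n ix k q))) has_derivative dlog_X n ix k p) (at p)"
proof -
  have pos: "Gamma_arg n ix k j q > 0" if "q \<in> generic n ix" "j \<in> {1..n}" for q j
    using Gamma_arg_pos[OF that(1)] that(2) by (simp add: Gamma_arg_def)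
  have summand: "((\<lambda>q. ln_Gamma (Gamma_arg n ix k j q)) has_derivative
      (\<lambda>h. Digamma (Gamma_arg n ix k j p) *
        ((gam n ix (k + int j) h - gam n ix k h) / (2 * (real n + 1))))) (at p)"
    if "j \<in> {1..n}" for j
  proof -
    have arg: "(Gamma_arg n ix k j has_derivative
        (\<lambda>h. (gam n ix (k + int j) h - gam n ix k h) / (2 * (real n + 1)))) (at p)"
      unfolding Gamma_arg_def[abs_def]
      by (auto intro!: derivative_eq_intros gam_has_derivative)
    have "(ln_Gamma has_derivative (\<lambda>y. Digamma (Gamma_arg n ix k j p) * y))
        (at (Gamma_arg n ix k j p))"
      using has_field_derivative_ln_Gamma_real[OF pos[OF assms that]]
      by (simp add: has_field_derivative_def)
    from has_derivative_compose[OF arg this] show ?thesis .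
  qed
  have "((\<lambda>q. \<Sum>j=1..n. ln_Gamma (Gamma_arg n ix k j q)) has_derivative dlog_X n ix k p) (at p)"
    unfolding dlog_X_def[abs_def] by (intro has_derivative_sum summand)
  then show ?thesis
  proof (rule has_derivative_transform_within_open[OF _ open_generic assms])
    fix q assume q: "q \<in> generic n ix"
    have "ln (X n k (\<lambda>k. gam n ix k q)) = ln (\<Prod>j=1..n. Gamma (Gamma_arg n ix k j q))"
      by (simp add: X_def Gamma_arg_def)
    also have "\<dots> = (\<Sum>j=1..n. ln (Gamma (Gamma_arg n ix k j q)))"
      by (rule ln_prod) (use pos[OF q] in \<open>auto dest: Gamma_real_pos simp: less_imp_neq[THEN not_sym]\<close>)
    also have "\<dots> = (\<Sum>j=1..n. ln_Gamma (Gamma_arg n ix k j q))"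
      using pos[OF q] by (intro sum.cong) (auto simp: ln_Gamma_real_pos)
    finally show "(\<Sum>j=1..n. ln_Gamma (Gamma_arg n ix k j q)) = ln (X n k (\<lambda>k. gam n ix k q))"
      by simp
  qed
qed

lemma ln_mon_e_has_derivative:
  assumes "p \<in> generic n ix"
  shows "((\<lambda>q. ln (mon_e n ix i q)) has_derivative
    (\<lambda>h. rho n ix (int i) h + 2 * ln 2 * gam n ix (int i) h
      + (dlog_X n ix (int n - int i) p h - dlog_X n ix (int i) p h))) (at p)"
proof -
  have "((\<lambda>q. rho n ix (int i) q + 2 * ln 2 * gam n ix (int i) q
      + (ln (X n (int n - int i) (\<lambda>k. gam n ix k q)) - ln (X n (int i) (\<lambda>k. gam n ix k q))))
    has_derivative
    (\<lambda>h. rho n ix (int i) h + 2 * ln 2 * gam n ix (int i) h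
      + (dlog_X n ix (int n - int i) p h - dlog_X n ix (int i) p h))) (at p)"
    by (intro has_derivative_add has_derivative_diff has_derivative_mult_right
        rho_has_derivative gam_has_derivative ln_X_has_derivative assms)
  then show ?thesis
  proof (rule has_derivative_transform_within_open[OF _ open_generic assms])
    fix q assume q: "q \<in> generic n ix"
    have "X n k (\<lambda>k. gam n ix k q) > 0" "X n k (\<lambda>k. gam n ix k q) \<noteq> 0" for k
      using X_pos[OF q, of k] by auto
    then show "rho n ix (int i) q + 2 * ln 2 * gam n ix (int i) q
        + (ln (X n (int n - int i) (\<lambda>k. gam n ix k q)) - ln (X n (int i) (\<lambda>k. gam n ix k q)))
      = ln (mon_e n ix i q)"
      unfolding mon_e_def by (simp add: ln_mult_pos ln_div ln_powr)
  qed
qed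

section \<open>Cancellation under the reflection of indices\<close>

text \<open>
  The summand changes sign under \<open>k \<mapsto> n - j - k\<close>, because the Gamma argument is invariant and the
  factors \<open>d\<gamma>\<^sub>k\<close> and \<open>d\<gamma>\<^sub>k\<^sub>+\<^sub>j\<close> trade places, each with a sign.
\<close>

lemma sum_wedge_digamma_zero:
  assumes "n \<ge> 1"
  shows "(\<Sum>k\<in>{0..<int n + 1}. Digamma (Gamma_arg n ix k j p) *
    (gam n ix k u * gam n ix (k + int j) v - gam n ix k v * gam n ix (k + int j) u)) = 0"
    (is "(\<Sum>k\<in>_. ?f k) = 0")
proof -
  have per: "?f (k mod (int n + 1)) = ?f k" for k
  proof -
    have "gam n ix (k mod (int n + 1) + int j) q = gam n ix (k + int j) q" for q
      by (metis gam_mod mod_add_left_eq)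
    then show ?thesis
      by (simp add: Gamma_arg_def gam_mod)
  qed
  have neg: "?f ((int n - int j) - k) = - ?f k" for k
  proof -
    have lower: "gam n ix (int n - int j - k) q = - gam n ix (k + int j) q" for q
      using gam_reflect[OF assms, of ix "k + int j" q] by (simp add: algebra_simps)
    have upper: "gam n ix (int n - int j - k + int j) q = - gam n ix k q" for q
      using gam_reflect[OF assms, of ix k q] by (simp add: algebra_simps)
    show ?thesis
      unfolding Gamma_arg_def lower upper by (simp add: algebra_simps)
  qed
  have "(\<Sum>k\<in>{0..<int n + 1}. ?f k) = (\<Sum>k\<in>{0..<int n + 1}. ?f ((int n - int j) - k))"
    by (rule sum_periodic_reflect[symmetric]) (simp, rule per)
  also have "\<dots> = - (\<Sum>k\<in>{0..<int n + 1}. ?f k)"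
    unfolding neg by (rule sum_negf)
  finally show ?thesis by simp
qed

lemma sum_wedge_gam_dlog_X_zero:
  assumes "n \<ge> 1"
  shows "(\<Sum>k=0..n. gam n ix (int k) u * dlog_X n ix (int k) p v
    - gam n ix (int k) v * dlog_X n ix (int k) p u) = 0"
proof -
  let ?S = "\<lambda>j k. Digamma (Gamma_arg n ix k j p) *
    (gam n ix k u * gam n ix (k + int j) v - gam n ix k v * gam n ix (k + int j) u)"
  have summand: "gam n ix k u * dlog_X n ix k p v - gam n ix k v * dlog_X n ix k p u
      = (\<Sum>j=1..n. ?S j k / (2 * (real n + 1)))" for k
    unfolding dlog_X_def sum_distrib_left sum_subtractf[symmetric]
  proof (rule sum.cong[OF refl])
    fix j
    have "a * (D * ((y - b) / c)) - b * (D * ((x - a) / c)) = D * (a * y - b * x) / c"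
      for a b x y c D :: real
      by (simp add: divide_inverse algebra_simps)
    then show "gam n ix k u * (Digamma (Gamma_arg n ix k j p) *
          ((gam n ix (k + int j) v - gam n ix k v) / (2 * (real n + 1))))
        - gam n ix k v * (Digamma (Gamma_arg n ix k j p) *
          ((gam n ix (k + int j) u - gam n ix k u) / (2 * (real n + 1))))
        = ?S j k / (2 * (real n + 1))" .
  qed
  have "(\<Sum>k=0..n. gam n ix (int k) u * dlog_X n ix (int k) p v
      - gam n ix (int k) v * dlog_X n ix (int k) p u)
    = (\<Sum>k\<in>{0..<int n + 1}. gam n ix k u * dlog_X n ix k p v - gam n ix k v * dlog_X n ix k p u)"
    by (rule sum.reindex_bij_witness[where i = nat and j = int]) auto
  also have "\<dots> = (\<Sum>j=1..n. (\<Sum>k\<in>{0..<int n + 1}. ?S j k) / (2 * (real n + 1)))"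
    unfolding summand sum_divide_distrib by (rule sum.swap)
  finally show ?thesis
    by (simp add: sum_wedge_digamma_zero[OF assms])
qed

theorem theorem4:
  fixes n :: nat and ix :: "nat \<Rightarrow> 'l::finite"
  assumes "n \<ge> 1"
    and "bij_betw ix {0..ell n} UNIV"
  shows "\<forall>p \<in> generic n ix. \<forall>u v.
    - (1/2) * (\<Sum>i=0..ell n. wedge (ext_d (gam n ix (int i))) (ext_d (rho n ix (int i))) p u v)
    = (\<Sum>i=0..ell n. wedge (ext_d (mon_m n ix i)) (ext_d (\<lambda>q. ln (mon_e n ix i q))) p u v)"
proof (intro ballI allI)
  fix p u v assume p: "p \<in> generic n ix"
  define W where "W k = gam n ix (int k) u * dlog_X n ix (int k) p v
    - gam n ix (int k) v * dlog_X n ix (int k) p u" for k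
  have dgam: "ext_d (gam n ix k) p = gam n ix k" for k
    by (rule ext_d_eqI[OF gam_has_derivative])
  have drho: "ext_d (rho n ix k) p = rho n ix k" for k
    by (rule ext_d_eqI[OF rho_has_derivative])
  have dm: "ext_d (mon_m n ix i) p = (\<lambda>h. - (1/2) * gam n ix (int i) h)" for i
    unfolding mon_m_def[abs_def]
    by (intro ext_d_eqI has_derivative_mult_right gam_has_derivative)
  note de = ext_d_eqI[OF ln_mon_e_has_derivative[OF p]]
  have summand: "wedge (ext_d (mon_m n ix i)) (ext_d (\<lambda>q. ln (mon_e n ix i q))) p u v
      = - (1/2) * wedge (ext_d (gam n ix (int i))) (ext_d (rho n ix (int i))) p u v
        + (1/2) * (W i + W (n - i))" if "i \<le> ell n" for i
  proof -
    have i: "int (n - i) = int n - int i"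
      using that by (simp add: ell_def of_nat_diff)
    show ?thesis
      unfolding wedge_def dgam drho dm de W_def i gam_reflect[OF assms(1)]
      by (simp add: field_simps)
  qed
  have mid: "W k = 0" if "2 * k = n" for k
  proof -
    have "int n - int k = int k"
      using that by simp
    then have "gam n ix (int k) q = 0" for q
      using gam_reflect[OF assms(1), of ix "int k" q] by simp
    then show ?thesis
      by (simp add: W_def)
  qed
  have "(\<Sum>i=0..ell n. W i + W (n - i)) = 0"
    using sum_fold_ell[of n W, OF assms(1) mid] sum_wedge_gam_dlog_X_zero[OF assms(1)]
    by (simp add: W_def)
  then show "- (1/2) * (\<Sum>i=0..ell n. wedge (ext_d (gam n ix (int i))) (ext_d (rho n ix (int i))) p u v)
    = (\<Sum>i=0..ell n. wedge (ext_d (mon_m n ix i)) (ext_d (\<lambda>q. ln (mon_e n ix i q))) p u v)"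
    by (simp add: summand sum.distrib sum_subtractf sum_divide_distrib[symmetric])
qed

end
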